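(* Let $(a_i)_{i\in\mathbb N}$ and $(b_i)_{i\in\mathbb N}$, $\mathbb N=\{1,2,\dots\}$, be real sequences such that $\sum_{i=1}^\infty a_i=1$, $0<a_i<1$ and $0<b_i<1$ for all $i\in\mathbb N$, and such that there exist $C>1$ and $0<\rho<1$ with $b_i<C\rho^i$ for all $i\in\mathbb N$. Consider the Markov chain with state space $\mathbb N$ whose transition probabilities $w(i,j)$ (the probability of transition from state $j$ to state $i$) are: $w(i,1)=a_i$ for all $i\in\mathbb N$; $w(2,2)=1-b_1$; $w(i-1,i)=b_{i-1}$ for all $i\ge2$; $w(1,i)=1-b_{i-1}$ for all $i\ge3$; and $w(i,j)=0$ otherwise. This Markov chain has a unique stationary probability measure $q=(q(i))_{i\in\mathbb N}$, given by $$q(i)=\frac{u(i)}{\sum_{j=1}^\infty|u(j)|},$$ where $u(i)=v(i)$ if $i=1,2$, $$u(i)=\sum_{k=1}^\infty\Big(\prod_{\ell=0}^{k-2}b_{i+\ell}\Big)a_{i+k-1}\,v(1)\quad\text{if } i\ge3,$$ and $(v(1),v(2))$ is any eigenvector of the matrix $$\mathscr R=\begin{bmatrix}1-\sum_{\ell=0}^\infty\big(\prod_{k=1}^\ell b_{k+1}\big)a_{\ell+2}& b_1\\ \sum_{\ell=0}^\infty\big(\prod_{k=1}^\ell b_{k+1}\big)a_{\ell+2}&1-b_1\end{bmatrix}$$ associated with the eigenvalue $\lambda=1$.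
   Context: A stationary probability measure is $q:\mathbb N\to[0,1]$ with $\sum_iq(i)=1$ and $\sum_{j\in\mathbb N}w(i,j)q(j)=q(i)$ for all $i\in\mathbb N$ (the matrix $(w(i,j))$ is stochastic in the sense that each column sums to $1$). Empty products equal $1$.
   Formalization: The formula for q is proved as stated for eigenvectors with v(1)>0; for eigenvectors with v(1)<0, where the stated formula would give negative values, it is proved with -u(i) in place of u(i) in the numerator. *)

theory Defs
  imports "HOL-Analysis.Infinite_Sum" "Jordan_Normal_Form.Char_Poly"
begin

text \<open>
  The state space \<open>{1, 2, \<dots>}\<close> is the set \<open>{1..}\<close> of type \<^typ>\<open>nat set\<close>; values of sequences
  and kernels at index \<open>0\<close> are never used. As in the source, \<open>w i j\<close> is the probability of moving
  from state \<open>j\<close> to state \<open>i\<close>, so it is the columns that sum to one.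
\<close>

text \<open>
  Functions are taken extensional (\<open>\<rightarrow>\<^sub>E\<close>), so that equality of two stationary
  measures means equality on \<open>{1..}\<close>.
\<close>

definition stationary_prob :: "(nat \<Rightarrow> nat \<Rightarrow> real) \<Rightarrow> (nat \<Rightarrow> real) \<Rightarrow> bool" where
  "stationary_prob w q \<longleftrightarrow>
     q \<in> {1..} \<rightarrow>\<^sub>E {0..1} \<and>
     (q has_sum 1) {1..} \<and>
     (\<forall>i\<ge>1. ((\<lambda>j. w i j * q j) has_sum q i) {1..})"

definition trans_prob :: "(nat \<Rightarrow> real) \<Rightarrow> (nat \<Rightarrow> real) \<Rightarrow> nat \<Rightarrow> nat \<Rightarrow> real" where
  "trans_prob a b i j =
     (if j = 1 then a i
      else if i = 2 \<and> j = 2 then 1 - b 1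
      else if j \<ge> 2 \<and> i = j - 1 then b (j - 1)
      else if j \<ge> 3 \<and> i = 1 then 1 - b (j - 1)
      else 0)"

definition R_term :: "(nat \<Rightarrow> real) \<Rightarrow> (nat \<Rightarrow> real) \<Rightarrow> nat \<Rightarrow> real" where
  "R_term a b l = (\<Prod>k=1..l. b (k + 1)) * a (l + 2)"

definition R_mat :: "(nat \<Rightarrow> real) \<Rightarrow> (nat \<Rightarrow> real) \<Rightarrow> real mat" where
  "R_mat a b = mat_of_rows_list 2
     [[1 - (\<Sum>\<^sub>\<infinity>l. R_term a b l), b 1],
      [(\<Sum>\<^sub>\<infinity>l. R_term a b l), 1 - b 1]]"

text \<open>
  The factors \<open>l = 0, \<dots>, k - 2\<close> are written \<open>l < k - 1\<close>: with truncated subtraction,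
  \<open>{0..k - 2}\<close> would not be empty for \<open>k = 1\<close>.
\<close>

definition u_term :: "(nat \<Rightarrow> real) \<Rightarrow> (nat \<Rightarrow> real) \<Rightarrow> real \<Rightarrow> nat \<Rightarrow> nat \<Rightarrow> real" where
  "u_term a b v1 i k = (\<Prod>l<k - 1. b (i + l)) * a (i + k - 1) * v1"

definition u_seq :: "(nat \<Rightarrow> real) \<Rightarrow> (nat \<Rightarrow> real) \<Rightarrow> real \<Rightarrow> real \<Rightarrow> nat \<Rightarrow> real" where
  "u_seq a b v1 v2 i =
     (if i = 1 then v1
      else if i = 2 then v2
      else (\<Sum>\<^sub>\<infinity>k\<in>{1..}. u_term a b v1 i k))"

end

theory Submission
  imports Defs
begin

text \<open>
  For \<open>i \<ge> 3\<close> the stationarity equation reads \<open>q i = a i * q 1 + b i * q (i + 1)\<close>; as \<open>b\<close> tends to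
  zero, its only bounded solution is the series \<open>tail i * q 1\<close>. Row 2 then becomes
  \<open>b 1 * q 2 = tail 2 * q 1\<close>, which is also the eigenvector equation of \<open>R_mat\<close>, so all stationary
  measures are proportional to one positive \<open>profile\<close>, summable since \<open>tail i \<le> a i + b i\<close>.
  Row 1 of that profile follows from the other rows because the columns of \<open>w\<close> sum to one.
\<close>

text \<open>For nonnegative terms unordered and ordered convergence agree, and \<open>Suc\<close>
  reindexes \<open>{1..}\<close>. This gives access to shifts and comparison of ordinary
  series.\<close>

lemma has_sum_atLeast_1_iff_sums:
  fixes f :: "nat \<Rightarrow> real"
  assumes "\<And>i. i \<ge> 1 \<Longrightarrow> 0 \<le> f i"
  shows "(f has_sum x) {1..} \<longleftrightarrow> (\<lambda>n. f (Suc n)) sums x"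
proof -
  have "bij_betw Suc UNIV {1..}"
    by (rule bij_betw_byWitness[of _ "\<lambda>k. k - 1"]) auto
  then have "(f has_sum x) {1..} \<longleftrightarrow> ((\<lambda>n. f (Suc n)) has_sum x) UNIV"
    by (simp add: has_sum_reindex_bij_betw[where f = f])
  also have "\<dots> \<longleftrightarrow> (\<lambda>n. f (Suc n)) sums x"
    using assms has_sum_imp_sums sums_nonneg_imp_has_sum[of "\<lambda>n. f (Suc n)" x] by auto
  finally show ?thesis .
qed

text \<open>The columns of \<open>R_mat\<close> sum to one, so both coordinates of the eigenvector
  condition reduce to one equation. The series is treated as an arbitrary number, so its convergence
  can be settled later.\<close>

lemma eigenvector_R_mat_iff:
  "eigenvector (R_mat a b) (vec_of_list [v1, v2]) 1 \<longleftrightarrow>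
     (v1, v2) \<noteq> (0, 0) \<and> b 1 * v2 = (\<Sum>\<^sub>\<infinity>l. R_term a b l) * v1"
proof -
  define s where "s = (\<Sum>\<^sub>\<infinity>l. R_term a b l)"
  have v: "vec_of_list [v1, v2] = vec 2 (\<lambda>i. if i = 0 then v1 else v2)"
    by (rule eq_vecI) (auto simp: less_Suc_eq numeral_2_eq_2)
  have M: "R_mat a b = mat 2 2 (\<lambda>(i, j). if i = 0 then (if j = 0 then 1 - s else b 1)
      else (if j = 0 then s else 1 - b 1))"
    by (rule eq_matI)
       (auto simp: R_mat_def mat_of_rows_list_def s_def less_Suc_eq numeral_2_eq_2)
  show ?thesis
    unfolding eigenvector_def v M s_def[symmetric]
    by (auto simp: vec_eq_iff scalar_prod_def less_Suc_eq numeral_2_eq_2 algebra_simps)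
qed

lemma stationary_prob_row:
  "stationary_prob w q \<Longrightarrow> i \<ge> 1 \<Longrightarrow> ((\<lambda>j. w i j * q j) has_sum q i) {1..}"
  unfolding stationary_prob_def by blast

section \<open>Tail series and the profile built from them\<close>

locale return_chain =
  fixes a b :: "nat \<Rightarrow> real"
  assumes a_sums: "(\<lambda>n. a (Suc n)) sums 1"
    and a_pos: "\<And>i. i \<ge> 1 \<Longrightarrow> 0 < a i"
    and b_pos: "\<And>i. i \<ge> 1 \<Longrightarrow> 0 < b i"
    and b_less_1: "\<And>i. i \<ge> 1 \<Longrightarrow> b i < 1"
    and b_summable: "summable (\<lambda>n. b (Suc n))"
begin

text \<open>For \<open>i >= 2\<close> this is the probability that the jump from state 1 lands at
  \<open>i + k\<close> and the chain then descends step by step to \<open>i\<close>. Summed over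
  \<open>k\<close>, it gives the probability of visiting \<open>i\<close> before returning to
  1.\<close>

definition tail_term :: "nat \<Rightarrow> nat \<Rightarrow> real" where
  "tail_term i k = (\<Prod>l<k. b (i + l)) * a (i + k)"

definition tail :: "nat \<Rightarrow> real" where
  "tail i = (\<Sum>k. tail_term i k)"

text \<open>Expected number of visits to \<open>i\<close> between consecutive returns to 1. States
  from 3 on are visited at most once; the loop at 2 makes the number of visits there geometric with
  mean \<open>1 / b 1\<close> once 2 is reached.\<close>

definition profile :: "nat \<Rightarrow> real" where
  "profile i = (if i = 1 then 1 else if i = 2 then tail 2 / b 1 else tail i)"

lemma tail_term_pos: "i \<ge> 1 \<Longrightarrow> 0 < tail_term i k"
  unfolding tail_term_def by (intro mult_pos_pos prod_pos ballI b_pos a_pos) auto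

lemma tail_term_le: "i \<ge> 1 \<Longrightarrow> tail_term i k \<le> a (i + k)"
  unfolding tail_term_def
  using a_pos[of "i + k"] b_pos b_less_1
  by (auto intro!: mult_left_le_one_le prod_le_1 prod_nonneg simp: less_imp_le)

lemma a_shift_summable: "i \<ge> 1 \<Longrightarrow> summable (\<lambda>k. a (i + k))"
  using summable_ignore_initial_segment[OF sums_summable[OF a_sums], of "i - 1"]
  by (simp add: add.commute)

lemma tail_term_summable: "i \<ge> 1 \<Longrightarrow> summable (tail_term i)"
  by (rule summable_comparison_test[OF _ a_shift_summable[of i]])
     (auto intro!: exI[of _ 0] simp: tail_term_le abs_of_pos tail_term_pos)

lemma tail_pos: "i \<ge> 1 \<Longrightarrow> 0 < tail i"
  unfolding tail_def by (intro suminf_pos tail_term_summable tail_term_pos)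

lemma tail_has_sum: "i \<ge> 1 \<Longrightarrow> (tail_term i has_sum tail i) UNIV"
  unfolding tail_def
  by (intro sums_nonneg_imp_has_sum summable_sums tail_term_summable)
     (simp_all add: less_imp_le tail_term_pos)

lemma tail_le_1:
  assumes "i \<ge> 1" shows "tail i \<le> 1"
proof -
  have "tail i \<le> (\<Sum>k. a (i + k))"
    unfolding tail_def
    by (intro suminf_le tail_term_le tail_term_summable a_shift_summable assms)
  also have "\<dots> = (\<Sum>n. a (Suc (n + (i - 1))))"
    using assms by (simp add: add.commute)
  also have "\<dots> \<le> (\<Sum>n. a (Suc n))"
    using suminf_split_initial_segment[OF sums_summable[OF a_sums], of "i - 1"]
      sum_nonneg[of "{..<i-1}" "\<lambda>n. a (Suc n)"] a_pos
    by (simp add: less_imp_le)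
  finally show ?thesis using sums_unique[OF a_sums] by simp
qed

lemma tail_term_Suc: "tail_term i (Suc k) = b i * tail_term (Suc i) k"
  by (simp add: tail_term_def prod.lessThan_Suc_shift del: prod.lessThan_Suc)

text \<open>Peeling off the term \<open>k = 0\<close> leaves a common factor \<open>b i\<close>. For
  \<open>i >= 3\<close> this is the row equation scaled to \<open>q 1 = 1\<close>.\<close>

lemma tail_rec:
  assumes "i \<ge> 1" shows "tail i = a i + b i * tail (Suc i)"
proof -
  have "tail i = tail_term i 0 + (\<Sum>k. tail_term i (Suc k))"
    unfolding tail_def using suminf_split_head[OF tail_term_summable[OF assms]] by simp
  also have "\<dots> = a i + b i * tail (Suc i)"
    unfolding tail_term_Suc tail_def
    by (simp add: suminf_mult tail_term_summable) (simp add: tail_term_def)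
  finally show ?thesis .
qed

lemma profile_pos: "i \<ge> 1 \<Longrightarrow> 0 < profile i"
  by (simp add: profile_def tail_pos b_pos)

lemma profile_summable: "summable (\<lambda>n. profile (Suc n))"
proof -
  \<comment> \<open>The shift by 2 starts the comparison at index 3, from which
    \<open>profile\<close> agrees with \<open>tail\<close>.\<close>
  have "summable (\<lambda>n. a (Suc (n + 2)) + b (Suc (n + 2)))"
    using sums_summable[OF a_sums] b_summable
    by (intro summable_add; subst summable_iff_shift[of _ 2])
  moreover have "norm (profile (Suc (n + 2))) \<le> a (Suc (n + 2)) + b (Suc (n + 2))" for n
  proof -
    have "profile (Suc (n + 2)) = a (Suc (n + 2)) + b (Suc (n + 2)) * tail (Suc (Suc (n + 2)))"
      unfolding profile_def using tail_rec[of "Suc (n + 2)"] by simp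
    also have "\<dots> \<le> a (Suc (n + 2)) + b (Suc (n + 2))"
      using mult_left_le[OF tail_le_1[of "Suc (Suc (n + 2))"], of "b (Suc (n + 2))"] b_pos
      by (simp add: less_imp_le)
    finally show ?thesis using profile_pos[of "Suc (n + 2)"] by simp
  qed
  ultimately have "summable (\<lambda>n. profile (Suc (n + 2)))"
    by (rule summable_comparison_test')
  then show ?thesis
    by (simp only: summable_iff_shift[of "\<lambda>n. profile (Suc n)" 2])
qed

text \<open>The mean return time to state 1.\<close>

definition mass :: real where
  "mass = (\<Sum>n. profile (Suc n))"

lemma mass_pos: "0 < mass"
  unfolding mass_def by (intro suminf_pos profile_summable profile_pos) simp

lemma profile_has_sum: "(profile has_sum mass) {1..}"
  by (subst has_sum_atLeast_1_iff_sums)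
     (simp_all add: mass_def less_imp_le profile_pos profile_summable summable_sums)

section \<open>Rows of the chain and stationarity of the normalised profile\<close>

lemma row_2_has_sum_iff:
  "((\<lambda>j. trans_prob a b 2 j * q j) has_sum x) {1..} \<longleftrightarrow>
     x = a 2 * q 1 + (1 - b 1) * q 2 + b 2 * q 3"
proof -
  \<comment> \<open>Row 2 is supported on columns 1, 2, 3, so the sum is finite and no sign or
    convergence condition on \<open>q\<close> arises.\<close>
  have "((\<lambda>j. trans_prob a b 2 j * q j) has_sum x) {1..} \<longleftrightarrow>
      ((\<lambda>j. trans_prob a b 2 j * q j) has_sum x) {1, 2, 3}"
    by (rule has_sum_cong_neutral) (auto simp: trans_prob_def)
  then show ?thesis
    by (simp add: has_sum_finite_iff trans_prob_def add.assoc)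
qed

lemma row_has_sum_iff:
  assumes "i \<ge> 3"
  shows "((\<lambda>j. trans_prob a b i j * q j) has_sum x) {1..} \<longleftrightarrow>
     x = a i * q 1 + b i * q (Suc i)"
proof -
  have "((\<lambda>j. trans_prob a b i j * q j) has_sum x) {1..} \<longleftrightarrow>
      ((\<lambda>j. trans_prob a b i j * q j) has_sum x) {1, Suc i}"
    using assms by (intro has_sum_cong_neutral) (auto simp: trans_prob_def)
  then show ?thesis
    using assms by (auto simp: has_sum_finite_iff trans_prob_def)
qed

lemma profile_row_1:
  "((\<lambda>j. trans_prob a b 1 j * profile j) has_sum profile 1) {1..}"
proof -
  let ?f = "\<lambda>n. trans_prob a b 1 (Suc n) * profile (Suc n)"
  have p: "(\<lambda>n. profile (n + 3)) sums (mass - 1 - profile 2)"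
  proof -
    have "(\<lambda>n. profile (Suc n)) sums mass"
      unfolding mass_def by (rule summable_sums[OF profile_summable])
    from sums_split_initial_segment[OF this, of 2] show ?thesis
      by (simp add: eval_nat_numeral profile_def diff_diff_eq)
  qed
  have p': "(\<lambda>n. profile (n + 4)) sums (mass - 1 - profile 2 - profile 3)"
    using sums_split_initial_segment[OF p, of 1] by (simp add: add.commute)
  have a': "(\<lambda>n. a (n + 3)) sums (1 - a 1 - a 2)"
    using sums_split_initial_segment[OF a_sums, of 2]
    by (simp add: numeral_2_eq_2 numeral_3_eq_3 diff_diff_eq)
  \<comment> \<open>Column \<open>n + 4\<close> contributes
    \<open>(1 - b (n + 3)) * profile (n + 4)\<close>, and \<open>tail_rec\<close> turns
    \<open>b (n + 3) * profile (n + 4)\<close> into \<open>profile (n + 3) - a (n + 3)\<close>. Row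
    1 from column 4 on thus combines the three series above, and \<open>mass\<close>
    cancels.\<close>
  have "(\<lambda>n. profile (n + 4) - (profile (n + 3) - a (n + 3))) sums
      ((mass - 1 - profile 2 - profile 3) - ((mass - 1 - profile 2) - (1 - a 1 - a 2)))"
    by (intro sums_diff p p' a')
  also have "(\<lambda>n. profile (n + 4) - (profile (n + 3) - a (n + 3))) = (\<lambda>n. ?f (n + 3))"
  proof
    fix n
    show "profile (n + 4) - (profile (n + 3) - a (n + 3)) = ?f (n + 3)"
      using tail_rec[of "n + 3"]
      by (simp add: profile_def trans_prob_def eval_nat_numeral algebra_simps)
  qed
  finally have "(\<lambda>n. ?f (n + 3)) sums (1 - a 1 - a 2 - profile 3)"
    by (simp add: algebra_simps)
  then have "?f sums (1 - a 1 - a 2 - profile 3 + (\<Sum>n<3. ?f n))"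
    by (subst (asm) sums_iff_shift) 
  \<comment> \<open>Columns 1, 2, 3 contribute \<open>a 1\<close>,
    \<open>b 1 * profile 2 = tail 2\<close> and \<open>(1 - b 2) * profile 3\<close>; the recursion
    for \<open>tail 2\<close> makes the total 1.\<close>
  also have "1 - a 1 - a 2 - profile 3 + (\<Sum>n<3. ?f n) = profile 1"
    using tail_rec[of 2] b_pos[of 1]
    by (simp add: eval_nat_numeral profile_def trans_prob_def field_simps)
  finally show ?thesis
    by (subst has_sum_atLeast_1_iff_sums)
      (auto intro!: mult_nonneg_nonneg
        simp: trans_prob_def less_imp_le a_pos b_pos b_less_1 profile_pos)
qed

lemma profile_row:
  assumes "i \<ge> 1"
  shows "((\<lambda>j. trans_prob a b i j * profile j) has_sum profile i) {1..}"
proof -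
  consider "i = 1" | "i = 2" | "i \<ge> 3" using assms by linarith
  then show ?thesis
  proof cases
    case 1
    then show ?thesis using profile_row_1 by simp
  next
    case 2
    then show ?thesis
      using tail_rec[of 2] b_pos[of 1]
      by (simp only: row_2_has_sum_iff) (simp add: profile_def field_simps eval_nat_numeral)
  next
    case 3
    then show ?thesis
      using tail_rec[of i] by (simp only: row_has_sum_iff) (simp add: profile_def)
  qed
qed

lemma stationary_prob_profile:
  "stationary_prob (trans_prob a b) (restrict (\<lambda>i. profile i / mass) {1..})"
proof -
  \<comment> \<open>A single nonnegative term is at most the total, which keeps the quotients in
    \<open>{0..1}\<close>.\<close>
  have le: "profile i \<le> mass" if "i \<ge> 1" for i
    using has_sum_mono_neutral[OF has_sum_finite[of "{i}" profile] profile_has_sum] that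
    by (auto simp: less_imp_le profile_pos)
  have "((\<lambda>i. profile i / mass) has_sum 1) {1..}"
    using has_sum_cmult_right[OF profile_has_sum, of "1 / mass"] mass_pos by simp
  moreover have "((\<lambda>j. trans_prob a b i j * (profile j / mass)) has_sum profile i / mass) {1..}"
    if "i \<ge> 1" for i
    using has_sum_cmult_right[OF profile_row[OF that], of "1 / mass"] by simp
  moreover have "restrict (\<lambda>i. profile i / mass) {1..} \<in> {1..} \<rightarrow>\<^sub>E {0..1}"
    using le mass_pos by (auto simp: less_imp_le profile_pos)
  moreover have "(restrict g {1..} has_sum x) {1..} \<longleftrightarrow> (g has_sum x) {1..}"
      "((\<lambda>j. w j * restrict g {1..} j) has_sum x) {1..} \<longleftrightarrow>
      ((\<lambda>j. w j * g j) has_sum x) {1..}" for w g :: "nat \<Rightarrow> real" and x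
    by (rule has_sum_cong; simp)+
  ultimately show ?thesis
    unfolding stationary_prob_def by simp
qed

section \<open>Uniqueness of the stationary measure\<close>

text \<open>
  Iterating the row equation \<open>q i = a i * q 1 + b i * q (i + 1)\<close> leaves a remainder which
  vanishes because \<open>q\<close> is bounded and \<open>b\<close> tends to zero.
\<close>

lemma stationary_prob_tail:
  assumes "stationary_prob (trans_prob a b) q" "i \<ge> 3"
  shows "q i = tail i * q 1"
proof -
  have q01: "0 \<le> q j \<and> q j \<le> 1" if "j \<ge> 1" for j
    using assms(1) that by (auto simp: stationary_prob_def PiE_def Pi_def)
  have step: "q j = a j * q 1 + b j * q (Suc j)" if "j \<ge> 3" for j
    using stationary_prob_row[OF assms(1), of j] that by (simp only: row_has_sum_iff)
  have iter: "q i = (\<Sum>k<n. tail_term i k) * q 1 + (\<Prod>l<n. b (i + l)) * q (i + n)" for n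
  proof (induction n)
    case (Suc n)
    then show ?case
      using step[of "i + n"] assms(2) by (simp add: tail_term_def algebra_simps)
  qed simp
  have "(\<lambda>n. b (Suc n)) \<longlonglongrightarrow> 0"
    by (rule summable_LIMSEQ_zero[OF b_summable])
  then have b_lim: "(\<lambda>n. b (i + n)) \<longlonglongrightarrow> 0"
    using assms(2) LIMSEQ_ignore_initial_segment[of "\<lambda>n. b (Suc n)" 0 "i - 1"]
    by (simp add: add.commute)
  \<comment> \<open>Taking \<open>Suc n\<close> factors guarantees a last factor
    \<open>b (i + n)\<close>, which tends to 0; the other factors and \<open>q\<close> are at most
    1.\<close>
  have "norm ((\<Prod>l<Suc n. b (i + l)) * q (i + Suc n)) \<le> b (i + n)" for n
  proof -
    have P: "0 \<le> (\<Prod>l<n. b (i + l))" "(\<Prod>l<n. b (i + l)) \<le> 1"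
      using assms(2) by (auto intro!: prod_nonneg prod_le_1 simp: less_imp_le b_pos b_less_1)
    have bq: "0 \<le> b (i + n) * q (i + Suc n)" "b (i + n) * q (i + Suc n) \<le> b (i + n)"
      using assms(2) q01[of "i + Suc n"] b_pos[of "i + n"] by (auto intro: mult_left_le)
    have "(\<Prod>l<n. b (i + l)) * (b (i + n) * q (i + Suc n)) \<le> b (i + n) * q (i + Suc n)"
      using P bq by (intro mult_left_le_one_le)
    then show ?thesis
      using P bq by (simp add: mult.assoc abs_of_nonneg del: add_Suc_right)
  qed
  then have "(\<lambda>n. (\<Prod>l<Suc n. b (i + l)) * q (i + Suc n)) \<longlonglongrightarrow> 0"
    by (intro tendsto_norm_zero_cancel[OF tendsto_sandwich[OF _ _ tendsto_const b_lim]]) auto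
  then have rem: "(\<lambda>n. (\<Prod>l<n. b (i + l)) * q (i + n)) \<longlonglongrightarrow> 0"
    by (rule LIMSEQ_imp_Suc)
  have "(\<lambda>n. \<Sum>k<n. tail_term i k) \<longlonglongrightarrow> tail i"
    unfolding tail_def using assms(2) by (intro summable_LIMSEQ tail_term_summable) simp
  then have "(\<lambda>n. (\<Sum>k<n. tail_term i k) * q 1 + (\<Prod>l<n. b (i + l)) * q (i + n))
      \<longlonglongrightarrow> tail i * q 1 + 0"
    by (intro tendsto_add tendsto_mult tendsto_const rem)
  then have "(\<lambda>n. q i) \<longlonglongrightarrow> tail i * q 1"
    by (simp only: iter[symmetric] add_0_right)
  then show ?thesis by (simp add: LIMSEQ_const_iff)
qed

text \<open>The rows from 2 on determine \<open>q\<close> up to the factor \<open>q 1\<close>, and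
  total mass one fixes that factor.\<close>

lemma stationary_prob_eq_profile:
  assumes q: "stationary_prob (trans_prob a b) q" and "i \<ge> 1"
  shows "q i = profile i / mass"
proof -
  have row2: "q 2 = a 2 * q 1 + (1 - b 1) * q 2 + b 2 * q 3"
    using stationary_prob_row[OF q, of 2] by (simp only: row_2_has_sum_iff)
  have "b 1 * q 2 = tail 2 * q 1"
    using row2 tail_rec[of 2] stationary_prob_tail[OF q, of 3]
    by (simp add: algebra_simps eval_nat_numeral)
  then have q2: "q 2 = q 1 * (tail 2 / b 1)"
    using b_pos[of 1] by (simp add: eq_divide_eq mult.commute)
  have eq: "q j = q 1 * profile j" if "j \<ge> 1" for j
  proof -
    consider "j = 1" | "j = 2" | "j \<ge> 3" using \<open>j \<ge> 1\<close> by linarith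
    then show ?thesis
    proof cases
      case 3
      then show ?thesis using stationary_prob_tail[OF q] by (simp add: profile_def)
    qed (simp_all add: profile_def q2)
  qed
  have "(q has_sum q 1 * mass) {1..}"
    by (rule has_sum_cong[THEN iffD2, OF eq has_sum_cmult_right[OF profile_has_sum]]) simp
  \<comment> \<open>Kac's formula: \<open>q 1\<close> is the reciprocal of the mean return
    time.\<close>
  then have "q 1 * mass = 1"
    using q has_sum_unique unfolding stationary_prob_def by blast
  then show ?thesis
    using eq[OF \<open>i \<ge> 1\<close>] mass_pos by (simp add: field_simps)
qed

lemma ex1_stationary_prob: "\<exists>!q. stationary_prob (trans_prob a b) q"
proof (rule ex1I[of "stationary_prob (trans_prob a b)", OF stationary_prob_profile])
  fix q assume q: "stationary_prob (trans_prob a b) q"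
  then have "q \<in> extensional {1..}"
    by (simp add: stationary_prob_def PiE_def)
  then show "q = restrict (\<lambda>i. profile i / mass) {1..}"
    using stationary_prob_eq_profile[OF q]
    by (intro extensionalityI[of _ "{1..}"]) auto
qed

section \<open>Identification with the matrix \<open>R_mat\<close> and the sequence
  \<open>u_seq\<close>\<close>

lemma R_term_eq_tail_term: "R_term a b = tail_term 2"
proof
  fix l
  \<comment> \<open>Both products run over the indices 2 to \<open>l + 1\<close> of
    \<open>b\<close>, so the series in \<open>R_mat\<close> is \<open>tail 2\<close>.\<close>
  have "(\<Prod>k=1..l. b (k + 1)) = (\<Prod>k<l. b (2 + k))"
    by (rule prod.reindex_bij_witness[of _ Suc "\<lambda>k. k - 1"]) auto
  then show "R_term a b l = tail_term 2 l"
    by (simp add: R_term_def tail_term_def add.commute)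
qed

text \<open>With \<open>k = Suc m\<close> the truncated \<open>k - 1\<close> is exactly
  \<open>m\<close>, and the term becomes \<open>v1 * tail_term i m\<close>.\<close>

lemma u_term_has_sum:
  assumes "i \<ge> 1"
  shows "(u_term a b v1 i has_sum v1 * tail i) {1..}"
proof -
  have "bij_betw Suc UNIV {1..}"
    by (rule bij_betw_byWitness[of _ "\<lambda>k. k - 1"]) auto
  moreover have "((\<lambda>k. u_term a b v1 i (Suc k)) has_sum v1 * tail i) UNIV"
    using has_sum_cmult_right[OF tail_has_sum[OF assms], of v1]
    by (simp add: u_term_def tail_term_def mult_ac)
  ultimately show ?thesis
    using has_sum_reindex_bij_betw by blast
qed

text \<open>The eigenvector equation fixes \<open>v2\<close> as \<open>v1 * profile 2\<close>; from
  3 on the entries are \<open>v1 * tail i\<close>.\<close>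

lemma u_seq_eq_profile:
  assumes "b 1 * v2 = tail 2 * v1" "i \<ge> 1"
  shows "u_seq a b v1 v2 i = v1 * profile i"
proof -
  have "v2 = v1 * (tail 2 / b 1)"
    using assms(1) b_pos[of 1] by (simp add: eq_divide_eq mult.commute)
  then show ?thesis
    using infsumI[OF u_term_has_sum[OF assms(2), of v1]]
    by (simp add: u_seq_def profile_def)
qed

end

theorem proposition5p1:
  fixes a b :: "nat \<Rightarrow> real"
  assumes "(a has_sum 1) {1..}"
    and "\<And>i. i \<ge> 1 \<Longrightarrow> 0 < a i \<and> a i < 1"
    and "\<And>i. i \<ge> 1 \<Longrightarrow> 0 < b i \<and> b i < 1"
    and "\<exists>C>1. \<exists>\<rho>. 0 < \<rho> \<and> \<rho> < 1 \<and> (\<forall>i\<ge>1. b i < C * \<rho> ^ i)"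
  shows "(\<exists>!q. stationary_prob (trans_prob a b) q) \<and>
    R_term a b summable_on UNIV \<and>
    (\<exists>v1 v2. eigenvector (R_mat a b) (vec_of_list [v1, v2]) 1) \<and>
    (\<forall>q v1 v2. stationary_prob (trans_prob a b) q \<and>
        eigenvector (R_mat a b) (vec_of_list [v1, v2]) 1 \<longrightarrow>
      (\<forall>i\<ge>3. u_term a b v1 i summable_on {1..}) \<and>
      (\<lambda>j. \<bar>u_seq a b v1 v2 j\<bar>) summable_on {1..} \<and>
      v1 \<noteq> 0 \<and>
      (v1 > 0 \<longrightarrow>
        (\<forall>i\<ge>1. q i = u_seq a b v1 v2 i / (\<Sum>\<^sub>\<infinity>j\<in>{1..}. \<bar>u_seq a b v1 v2 j\<bar>))) \<and>
      (v1 < 0 \<longrightarrow>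
        (\<forall>i\<ge>1. q i = - u_seq a b v1 v2 i / (\<Sum>\<^sub>\<infinity>j\<in>{1..}. \<bar>u_seq a b v1 v2 j\<bar>))))"
proof -
  obtain C \<rho> where \<rho>: "0 < \<rho>" "\<rho> < 1" and C: "\<And>i. i \<ge> 1 \<Longrightarrow> b i < C * \<rho> ^ i"
    using assms(4) by blast
  \<comment> \<open>The geometric bound enters through summability of \<open>b\<close>, which makes
    \<open>profile\<close> summable and drives \<open>b\<close> to 0.\<close>
  have "summable (\<lambda>n. C * \<rho> ^ Suc n)"
    using \<rho> by (intro summable_mult) (simp add: summable_geometric)
  then have b_sum: "summable (\<lambda>n. b (Suc n))"
  proof (rule summable_comparison_test'[where N = 0])
    fix n show "norm (b (Suc n)) \<le> C * \<rho> ^ Suc n"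
      using C[of "Suc n"] assms(3)[of "Suc n"] by simp
  qed
  interpret return_chain a b
    using assms(1-3) b_sum has_sum_atLeast_1_iff_sums[of a 1]
    by unfold_locales (auto intro: less_imp_le)
  have R: "(R_term a b has_sum tail 2) UNIV"
    by (simp add: R_term_eq_tail_term tail_has_sum)
  have eig: "eigenvector (R_mat a b) (vec_of_list [v1, v2]) 1 \<longleftrightarrow>
      (v1, v2) \<noteq> (0, 0) \<and> b 1 * v2 = tail 2 * v1" for v1 v2
    unfolding eigenvector_R_mat_iff infsumI[OF R] by simp
  have ev: "\<exists>v1 v2. eigenvector (R_mat a b) (vec_of_list [v1, v2]) 1"
    \<comment> \<open>The witness is \<open>(profile 1, profile 2)\<close>.\<close>
    unfolding eig using b_pos[of 1] by (intro exI[of _ 1] exI[of _ "tail 2 / b 1"]) simp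
  have formula: "(\<forall>i\<ge>3. u_term a b v1 i summable_on {1..}) \<and>
      (\<lambda>j. \<bar>u_seq a b v1 v2 j\<bar>) summable_on {1..} \<and>
      v1 \<noteq> 0 \<and>
      (v1 > 0 \<longrightarrow>
        (\<forall>i\<ge>1. q i = u_seq a b v1 v2 i / (\<Sum>\<^sub>\<infinity>j\<in>{1..}. \<bar>u_seq a b v1 v2 j\<bar>))) \<and>
      (v1 < 0 \<longrightarrow>
        (\<forall>i\<ge>1. q i = - u_seq a b v1 v2 i / (\<Sum>\<^sub>\<infinity>j\<in>{1..}. \<bar>u_seq a b v1 v2 j\<bar>)))"
    if q: "stationary_prob (trans_prob a b) q"
      and e: "eigenvector (R_mat a b) (vec_of_list [v1, v2]) 1" for q v1 v2
  proof -
    \<comment> \<open>If \<open>v1 = 0\<close>, then \<open>b 1 > 0\<close> forces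
      \<open>v2 = 0\<close>, which is excluded for an eigenvector.\<close>
    have v: "b 1 * v2 = tail 2 * v1" and v1: "v1 \<noteq> 0"
      using e b_pos[of 1] unfolding eig by auto
    have "((\<lambda>j. \<bar>v1\<bar> * profile j) has_sum \<bar>v1\<bar> * mass) {1..}"
      by (rule has_sum_cmult_right[OF profile_has_sum])
    also have "?this \<longleftrightarrow> ((\<lambda>j. \<bar>u_seq a b v1 v2 j\<bar>) has_sum \<bar>v1\<bar> * mass) {1..}"
      by (rule has_sum_cong) (simp add: u_seq_eq_profile[OF v] abs_mult abs_of_pos profile_pos)
    finally have u: "((\<lambda>j. \<bar>u_seq a b v1 v2 j\<bar>) has_sum \<bar>v1\<bar> * mass) {1..}" .
    have "u_term a b v1 i summable_on {1..}" if "i \<ge> 3" for i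
      using u_term_has_sum[of i v1] that by (auto intro: has_sum_imp_summable)
    moreover have "q i = profile i / mass" "u_seq a b v1 v2 i = v1 * profile i" if "i \<ge> 1" for i
      using that by (simp_all add: stationary_prob_eq_profile[OF q] u_seq_eq_profile[OF v])
    \<comment> \<open>The quotient \<open>v1 * profile i / (\<bar>v1\<bar> * mass)\<close> is
      \<open>q i\<close> times the sign of \<open>v1\<close>, hence the minus sign for negative
      \<open>v1\<close>.\<close>
    ultimately show ?thesis
      unfolding infsumI[OF u] using has_sum_imp_summable[OF u] v1 by simp
  qed
  show ?thesis
    by (rule conjI[OF ex1_stationary_prob conjI[OF has_sum_imp_summable[OF R] conjI[OF ev]]],
        intro allI impI, elim conjE, rule formula)
qed

end
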